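(* Let $k\geq 2$ be an integer, and for $0\leq i<k$ let $\mathbf{a}_i=\{a_i(n)\}_{n\geq 0}$ and $\mathbf{b}_i=\{b_i(n)\}_{n\geq 0}$ be integer sequences such that each $\mathbf{a}_i$ is $k$-automatic and each $\mathbf{b}_i$ is $k$-regular. Assume that $b_0(0)=N(1-a_0(0))$ for some integer $N$. Let $f_i(x)=\mathbf{a}_i x+\mathbf{b}_i$ for $0\leq i<k$, and let $\mathbf{u}=\{u(n)\}_{n\geq 0}=\mathcal{G}(f_0,f_1,\dots,f_{k-1})$ be the polynomial generated sequence, i.e. the unique integer sequence satisfying $$u(kn+i)=a_i(n)u(n)+b_i(n)\qquad (0\leq i<k,\ n\geq 0),$$ with the convention that $u(0)=0$ if $a_0(0)=1$. Then $\mathbf{u}$ is $k$-regular.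
   Context: The $k$-kernel of a sequence $\mathbf{u}=\{u(n)\}_{n\geq 0}$ is the set of subsequences $\mathcal{K}_k(\mathbf{u})=\{\{u(k^i n+j)\}_{n\geq 0}: i\geq 0,\ 0\leq j<k^i\}$. A sequence taking values in a finite set is $k$-automatic if its $k$-kernel is a finite set. An integer sequence $\{u(n)\}_{n\geq 0}$ is $k$-regular (over $\mathbb{Z}$) if there exist finitely many integer sequences $\{a_1(n)\}_{n\geq 0},\dots,\{a_M(n)\}_{n\geq 0}$ such that every element of its $k$-kernel is a $\mathbb{Z}$-linear combination of them. If $a_0(0)\neq 1$, the recurrence at $n=0,i=0$ forces $u(0)=b_0(0)/(1-a_0(0))=N$; if $a_0(0)=1$ then $b_0(0)=0$ and $u(0)$ is set to $0$ by convention. All other values are then determined by the recurrence. *)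

theory Defs
  imports Main
begin

definition k_kernel :: "nat \<Rightarrow> (nat \<Rightarrow> 'a) \<Rightarrow> (nat \<Rightarrow> 'a) set" where
  "k_kernel k u = {\<lambda>n. u (k ^ i * n + j) | i j. j < k ^ i}"

definition k_automatic :: "nat \<Rightarrow> (nat \<Rightarrow> 'a) \<Rightarrow> bool" where
  "k_automatic k u \<longleftrightarrow> finite (range u) \<and> finite (k_kernel k u)"

text \<open>Regularity over the integers. The sequences \<open>g 0, \<dots>, g (M - 1)\<close> need not lie in the kernel.\<close>

definition k_regular :: "nat \<Rightarrow> (nat \<Rightarrow> int) \<Rightarrow> bool" where
  "k_regular k u \<longleftrightarrow>
     (\<exists>(M::nat) (g :: nat \<Rightarrow> nat \<Rightarrow> int). \<forall>v \<in> k_kernel k u.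
        \<exists>c :: nat \<Rightarrow> int. \<forall>n. v n = (\<Sum>m<M. c m * g m n))"

text \<open>
  The family \<open>f\<^sub>i(x) = a\<^sub>i x + b\<^sub>i\<close> is represented by its coefficient sequences:
  \<open>a i n\<close> is \<open>a\<^sub>i(n)\<close> and \<open>b i n\<close> is \<open>b\<^sub>i(n)\<close>. Only the indices \<open>i < k\<close> matter.
\<close>

definition generates ::
  "nat \<Rightarrow> (nat \<Rightarrow> nat \<Rightarrow> int) \<Rightarrow> (nat \<Rightarrow> nat \<Rightarrow> int) \<Rightarrow> (nat \<Rightarrow> int) \<Rightarrow> bool" where
  "generates k a b u \<longleftrightarrow>
     (\<forall>n. \<forall>i<k. u (k * n + i) = a i n * u n + b i n) \<and>
     (a 0 0 = 1 \<longrightarrow> u 0 = 0)"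

definition poly_generated ::
  "nat \<Rightarrow> (nat \<Rightarrow> nat \<Rightarrow> int) \<Rightarrow> (nat \<Rightarrow> nat \<Rightarrow> int) \<Rightarrow> nat \<Rightarrow> int" where
  "poly_generated k a b = (THE u. generates k a b u)"

text \<open>
  The definite description is meaningful under the divisibility condition on \<open>b\<^sub>0(0)\<close>.
\<close>

lemma generates_ex1:
  fixes k :: nat and a b :: "nat \<Rightarrow> nat \<Rightarrow> int" and N :: int
  assumes k: "2 \<le> k" and N: "b 0 0 = N * (1 - a 0 0)"
  shows "\<exists>!u. generates k a b u"
proof (rule ex_ex1I)
  define F where "F = (\<lambda>f n. if n = 0 then (if a 0 0 = 1 then 0 else N)
     else a (n mod k) (n div k) * f (n div k) + b (n mod k) (n div k))"
  define u where "u = wfrec less_than F"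
  have u0: "u 0 = (if a 0 0 = 1 then 0 else N)"
    unfolding u_def by (subst wfrec) (simp_all add: F_def)
  have uS: "u n = a (n mod k) (n div k) * u (n div k) + b (n mod k) (n div k)" if "n > 0" for n
  proof -
    have "n div k < n" using that k by simp
    then show ?thesis
      using that unfolding u_def by (subst wfrec) (simp_all add: F_def cut_apply)
  qed
  have "u (k * n + i) = a i n * u n + b i n" if "i < k" for n i
  proof (cases "k * n + i = 0")
    case True
    then have "n = 0" "i = 0" using k by auto
    then show ?thesis by (cases "a 0 0 = 1") (simp_all add: u0 N algebra_simps)
  next
    case False
    then show ?thesis using uS[of "k * n + i"] that k by simp
  qed
  then have "generates k a b u" by (simp add: generates_def u0)
  then show "\<exists>u. generates k a b u" by blast
next
  fix u v assume u: "generates k a b u" and v: "generates k a b v"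
  have rec: "w n = a (n mod k) (n div k) * w (n div k) + b (n mod k) (n div k)"
    if "generates k a b w" for w n
  proof -
    have "n mod k < k" using k by simp
    then have "w (k * (n div k) + n mod k)
        = a (n mod k) (n div k) * w (n div k) + b (n mod k) (n div k)"
      using that unfolding generates_def by blast
    then show ?thesis by simp
  qed
  have "u n = v n" for n
  proof (induction n rule: less_induct)
    case (less n)
    show ?case
    proof (cases "n = 0")
      case True
      have "(1 - a 0 0) * u 0 = (1 - a 0 0) * v 0"
        using rec[OF u, of 0] rec[OF v, of 0] by (simp add: algebra_simps)
      then show ?thesis using True u v by (auto simp: generates_def)
    next
      case False
      then have "u (n div k) = v (n div k)" using k by (intro less) simp
      then show ?thesis using rec[OF u, of n] rec[OF v, of n] by simp
    qed
  qed
  then show "u = v" by blast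
qed

lemma generates_poly_generated:
  fixes k :: nat and a b :: "nat \<Rightarrow> nat \<Rightarrow> int" and N :: int
  assumes "2 \<le> k" and "b 0 0 = N * (1 - a 0 0)"
  shows "generates k a b (poly_generated k a b)"
  unfolding poly_generated_def using generates_ex1[of k b N a, OF assms] by (rule theI')

end

(* Each kernel sequence of u arises from u by repeatedly multiplying by a kernel sequence of
   some a_i and adding a kernel sequence of some b_i.  The kernel sequences of all the a_i are finitely
   many and take finitely many values, so there is a map tau from the naturals to a finite set through
   which they all factor.  The combinations of u and the generators of the b_i with
   coefficients that are functions of tau n are closed under these two operations, and they are
   exactly the integer combinations of the finitely many products of a generator with the
   indicator of a fibre of tau. *)

theory Submission
  imports Defs
begin

lemma k_kernelI: "j < k ^ i \<Longrightarrow> (\<lambda>n. u (k ^ i * n + j)) \<in> k_kernel k u"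
  unfolding k_kernel_def by blast

text \<open>Enumerating \<open>I\<close> by a bijection from an initial segment of the naturals
  gives the indexing that \<open>k_regular\<close> asks for, so generators may be indexed by pairs
  below.\<close>

lemma k_regularI:
  fixes g :: "'i \<Rightarrow> nat \<Rightarrow> int"
  assumes "finite I"
    and "\<And>v. v \<in> k_kernel k u \<Longrightarrow> \<exists>c. \<forall>n. v n = (\<Sum>x\<in>I. c x * g x n)"
  shows "k_regular k u"
proof -
  obtain h where h: "bij_betw h {..<card I} I"
    using ex_bij_betw_nat_finite[OF \<open>finite I\<close>] by (auto simp: atLeast0LessThan)
  have "\<exists>c. \<forall>n. v n = (\<Sum>m<card I. c m * g (h m) n)" if v: "v \<in> k_kernel k u" for v
  proof -
    obtain c where c: "\<And>n. v n = (\<Sum>x\<in>I. c x * g x n)"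
      using assms(2)[OF v] by blast
    have "v n = (\<Sum>m<card I. c (h m) * g (h m) n)" for n
      unfolding c by (rule sum.reindex_bij_betw[OF h, symmetric])
    then show ?thesis by (intro exI[of _ "\<lambda>m. c (h m)"]) simp
  qed
  then show ?thesis
    unfolding k_regular_def by (intro exI[of _ "card I"] exI[of _ "\<lambda>m. g (h m)"]) blast
qed

text \<open>Take \<open>t n\<close> to be the tuple of all values \<open>h n\<close>, with
  \<open>h\<close> itself as the coordinate. Finitely many coordinates, each with finitely many
  values, allow only finitely many tuples; the fixed value \<open>undefined\<close> off
  \<open>H\<close> adds no more.\<close>

lemma finite_range_factor:
  assumes "finite H" and "\<And>h. h \<in> H \<Longrightarrow> finite (range h)"
  obtains t :: "'a \<Rightarrow> ('a \<Rightarrow> 'b) \<Rightarrow> 'b"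
  where "finite (range t)" and "\<And>h n. h \<in> H \<Longrightarrow> h n = t n h"
proof -
  define t :: "'a \<Rightarrow> ('a \<Rightarrow> 'b) \<Rightarrow> 'b" where "t n h = (if h \<in> H then h n else undefined)" for n h
  let ?V = "\<Union>h\<in>H. range h"
  have "range t \<subseteq> {f. \<forall>h. (h \<in> H \<longrightarrow> f h \<in> ?V) \<and> (h \<notin> H \<longrightarrow> f h = undefined)}"
    by (auto simp: t_def)
  moreover have "finite ?V" using assms by blast
  ultimately have "finite (range t)"
    by (intro finite_subset[OF _ finite_set_of_finite_funs[OF assms(1)]])
  then show ?thesis using that by (simp add: t_def)
qed

text \<open>A kernel sequence takes only values of the original sequence, so the union of the
  kernels is a finite set of sequences of finite range.\<close>

lemma k_automatic_family_factor:
  assumes "finite J" and "\<And>i. i \<in> J \<Longrightarrow> k_automatic k (a i)"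
  obtains t :: "nat \<Rightarrow> (nat \<Rightarrow> 'a) \<Rightarrow> 'a"
  where "finite (range t)" and "\<And>i h n. i \<in> J \<Longrightarrow> h \<in> k_kernel k (a i) \<Longrightarrow> h n = t n h"
proof -
  have fin: "finite (\<Union>i\<in>J. k_kernel k (a i))"
    using assms by (auto simp: k_automatic_def)
  have range: "finite (range h)" if h: "h \<in> (\<Union>i\<in>J. k_kernel k (a i))" for h
  proof -
    obtain i where i: "i \<in> J" "h \<in> k_kernel k (a i)" using h by blast
    then have "range h \<subseteq> range (a i)" by (auto simp: k_kernel_def)
    then show ?thesis using assms(2)[OF i(1)] finite_subset by (auto simp: k_automatic_def)
  qed
  show ?thesis
    by (rule finite_range_factor[OF fin range]) (auto intro: that)
qed

theorem theorem1:
  fixes k :: nat and a b :: "nat \<Rightarrow> nat \<Rightarrow> int" and N :: int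
  assumes "2 \<le> k"
    and "\<And>i. i < k \<Longrightarrow> k_automatic k (a i)"
    and "\<And>i. i < k \<Longrightarrow> k_regular k (b i)"
    and "b 0 0 = N * (1 - a 0 0)"
  shows "k_regular k (poly_generated k a b)"
proof -
  define u where "u = poly_generated k a b"
  have rec: "u (k * n + i) = a i n * u n + b i n" if "i < k" for n i
    using generates_poly_generated[of k b N a, OF assms(1,4)] that
    by (simp add: generates_def u_def)
  obtain t :: "nat \<Rightarrow> (nat \<Rightarrow> int) \<Rightarrow> int" where fin: "finite (range t)"
    and t: "\<And>i h n. i < k \<Longrightarrow> h \<in> k_kernel k (a i) \<Longrightarrow> h n = t n h"
    using k_automatic_family_factor[of "{..<k}" k a] assms(2) by auto
  have "\<exists>(M::nat) g. i < k \<longrightarrow> (\<forall>v\<in>k_kernel k (b i). \<exists>c. \<forall>n. v n = (\<Sum>m<M. c m * g m n))" for i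
    by (cases "i < k") (use assms(3)[of i] in \<open>simp_all add: k_regular_def\<close>)
  then obtain M :: "nat \<Rightarrow> nat" and g :: "nat \<Rightarrow> nat \<Rightarrow> nat \<Rightarrow> int"
    where g: "\<And>i v. i < k \<Longrightarrow> v \<in> k_kernel k (b i) \<Longrightarrow> \<exists>c. \<forall>n. v n = (\<Sum>m<M i. c m * g i m n)"
    by metis
  \<comment> \<open>index \<open>(i, m)\<close> stands for the \<open>m\<close>-th generator of \<open>b i\<close>, and \<open>(k, 0)\<close> for \<open>u\<close>\<close>
  define I where "I = Sigma {..k} (\<lambda>i. if i = k then {..<1} else {..<M i})"
  define G where "G = (\<lambda>(i, m). if i = k then u else g i m)"
  have finI: "finite I" by (simp add: I_def)
  define W where "W v \<longleftrightarrow> (\<exists>C. \<forall>n. v n = (\<Sum>x\<in>I. C x (t n) * G x n))" for v :: "nat \<Rightarrow> int"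
  have W_add: "W (\<lambda>n. v n + w n)" if "W v" "W w" for v w
  proof -
    from that obtain C D where "\<And>n. v n = (\<Sum>x\<in>I. C x (t n) * G x n)"
      "\<And>n. w n = (\<Sum>x\<in>I. D x (t n) * G x n)" unfolding W_def by blast
    then show ?thesis unfolding W_def
      by (intro exI[of _ "\<lambda>x s. C x s + D x s"]) (simp add: sum.distrib distrib_right)
  qed
  have W_mult: "W (\<lambda>n. h n * v n)" if "W v" "i < k" "h \<in> k_kernel k (a i)" for v h i
  proof -
    from \<open>W v\<close> obtain C where "\<And>n. v n = (\<Sum>x\<in>I. C x (t n) * G x n)" unfolding W_def by blast
    \<comment> \<open>The value \<open>s = t n\<close> determines \<open>h n\<close> as
      \<open>s h\<close>, so the factor is absorbed into the coefficient.\<close>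
    then show ?thesis unfolding W_def using t[OF that(2,3)]
      by (intro exI[of _ "\<lambda>x s. s h * C x s"]) (simp add: sum_distrib_left mult.assoc)
  qed
  have W_sum: "W v" if "J \<subseteq> I" "\<And>n. v n = (\<Sum>x\<in>J. c x * G x n)" for v c J
    unfolding W_def
  proof (intro exI allI)
    fix n
    have "(\<Sum>x\<in>I. (if x \<in> J then c x else 0) * G x n) = (\<Sum>x\<in>I. if x \<in> J then c x * G x n else 0)"
      by (rule sum.cong) auto
    also have "\<dots> = (\<Sum>x\<in>J. c x * G x n)"
      using that(1) finI by (simp add: sum.inter_restrict[symmetric] Int_absorb1)
    finally show "v n = (\<Sum>x\<in>I. (\<lambda>x _. if x \<in> J then c x else 0) x (t n) * G x n)"
      using that(2) by simp
  qed
  have W_u: "W u"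
    by (rule W_sum[of "{(k, 0)}" _ "\<lambda>_. 1"]) (auto simp: I_def G_def)
  have W_b: "W v" if i: "i < k" and v: "v \<in> k_kernel k (b i)" for v i
  proof -
    obtain c where c: "\<And>n. v n = (\<Sum>m<M i. c m * g i m n)" using g[OF i v] by blast
    have "(\<Sum>x\<in>Pair i ` {..<M i}. c (snd x) * G x n) = v n" for n
      using i by (subst sum.reindex) (auto simp: inj_on_def G_def c)
    then show ?thesis
      using i by (intro W_sum[of "Pair i ` {..<M i}" _ "\<lambda>x. c (snd x)"]) (auto simp: I_def)
  qed
  have W_kernel: "W (\<lambda>n. u (k ^ e * n + j))" if "j < k ^ e" for e j
    using that
  proof (induction e arbitrary: j)
    case 0
    then show ?case using W_u by simp
  next
    case (Suc e)
    \<comment> \<open>Splitting off the lowest base-\<open>k\<close> digit \<open>r\<close> of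
      \<open>j\<close> lets the recurrence apply once. Then \<open>u\<close>, \<open>a r\<close> and
      \<open>b r\<close> are all read along the same progression
      \<open>k ^ e * n + q\<close>.\<close>
    define r q where "r = j mod k" and "q = j div k"
    have r: "r < k" using assms(1) by (simp add: r_def)
    have q: "q < k ^ e" using Suc.prems by (simp add: q_def less_mult_imp_div_less mult.commute)
    have "k ^ Suc e * n + j = k * (k ^ e * n + q) + r" for n
      by (simp add: r_def q_def distrib_left mult.assoc)
    then have "(\<lambda>n. u (k ^ Suc e * n + j))
        = (\<lambda>n. a r (k ^ e * n + q) * u (k ^ e * n + q) + b r (k ^ e * n + q))"
      by (simp only: rec[OF r])
    then show ?case
      using W_add[OF W_mult[OF Suc.IH[OF q] r k_kernelI[OF q]] W_b[OF r k_kernelI[OF q]]] by simp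
  qed
  have "k_regular k u"
  proof (rule k_regularI[where I = "I \<times> range t"
        and g = "\<lambda>(x, s) n. if s = t n then G x n else 0"])
    show "finite (I \<times> range t)" using finI fin by simp
  next
    fix v assume "v \<in> k_kernel k u"
    then have "W v" using W_kernel by (auto simp: k_kernel_def)
    then obtain C where C: "\<And>n. v n = (\<Sum>x\<in>I. C x (t n) * G x n)" unfolding W_def by blast
    \<comment> \<open>For fixed \<open>x\<close> only the term \<open>s = t n\<close> survives, so
      the coefficients \<open>C x s\<close> no longer depend on \<open>n\<close>.\<close>
    have "v n = (\<Sum>(x, s)\<in>I \<times> range t. C x s * (if s = t n then G x n else 0))" for n
      using fin by (simp add: C sum.cartesian_product[symmetric] if_distrib cong: if_cong)
    then show "\<exists>c. \<forall>n. v n = (\<Sum>x\<in>I \<times> range t.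
        c x * (case x of (x, s) \<Rightarrow> \<lambda>n. if s = t n then G x n else 0) n)"
      by (intro exI[of _ "\<lambda>(x, s). C x s"]) (simp add: case_prod_unfold)
  qed
  then show ?thesis by (simp add: u_def)
qed

end
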